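(* Let $\underline\tau=(\tau_1,\ldots,\tau_d)\in(K\setminus\{0\})^d$ and let $\underline\Lambda=(\Lambda_1,\ldots,\Lambda_d)\in(\mathrm{GL}_\nu(K))^d$ be a $d$-tuple of mutually commuting matrices such that all the eigenvalues of $\Lambda_1,\ldots,\Lambda_d$ are in $K\setminus\mathbb{Z}$. Let $Y(\underline x)=\sum_{\underline\alpha\in\mathbb{N}^d\cup(-\mathbb{N})^d}Y_{\underline\alpha}\underline x^{\underline\alpha}$ be a $1\times\nu$ matrix with entries in $K[[\underline x,1/\underline x]]$ and let $f=Y(\underline x)\underline x^{\underline\Lambda}$. Assume that all the entries of $f$ are solutions of a differential equation $\phi\in K[x_1,\ldots,x_d,\partial_1,\ldots,\partial_d]$. Then all the entries of $\mathcal{L}^{\underline\tau}_{\underline\Lambda}(f)$ are solutions of $\mathcal{F}_{\underline\tau}(\phi)$.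
   Context: $K$ is a number field, $d,\nu\ge1$, $\underline x=(x_1,\ldots,x_d)$, $\partial_i=\partial/\partial x_i$, $\mathbb{I}_\nu$ the identity matrix. For a square matrix $\Lambda$ over $K$, $x^\Lambda=\exp(\Lambda\log x)=\sum_{n\ge0}\Lambda^n(\log x)^n/n!$, which satisfies $\frac{d}{dx}x^\Lambda=\Lambda x^{-1}x^{\Lambda}$; and $\underline x^{\underline\Lambda}=x_1^{\Lambda_1}\cdots x_d^{\Lambda_d}$. For $\tau\in K\setminus\{0\}$ and $\Lambda\in\mathrm{GL}_\nu(K)$ with all eigenvalues in $K\setminus\mathbb{Z}$, $C_{\Lambda,\tau}:\mathbb{Z}\to\mathrm{GL}_\nu(K)$ is defined by $C_{\Lambda,\tau}(n)=\tau^{-n}(\Lambda+n\mathbb{I}_\nu)(\Lambda+(n-1)\mathbb{I}_\nu)\cdots(\Lambda+\mathbb{I}_\nu)$ if $n\ge1$; $C_{\Lambda,\tau}(0)=\mathbb{I}_\nu$; $C_{\Lambda,\tau}(n)=\tau^{-n}\Lambda^{-1}(\Lambda-\mathbb{I}_\nu)^{-1}\cdots(\Lambda+(n+1)\mathbb{I}_\nu)^{-1}$ if $n\le-1$. The formal Laplace transform of $f=Y(\underline x)\underline x^{\underline\Lambda}$ with respect to $\underline\Lambda$ and $\underline\tau$ is $$\mathcal{L}^{\underline\tau}_{\underline\Lambda}(Y(\underline x)\underline x^{\underline\Lambda})=\sum_{\underline\alpha\in\mathbb{N}^d\cup(-\mathbb{N})^d}Y_{\underline\alpha}\prod_{1\le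 i\le d}C_{\Lambda_i,\tau_i}(\alpha_i)\,x_i^{-\Lambda_i-(\alpha_i+1)\mathbb{I}_\nu}.$$ $\mathcal{F}_{\underline\tau}$ is the $K$-automorphism of $K[x_1,\ldots,x_d,\partial_1,\ldots,\partial_d]$ determined by $\mathcal{F}_{\underline\tau}(x_i)=-\frac1{\tau_i}\partial_i$ and $\mathcal{F}_{\underline\tau}(\partial_i)=\tau_i x_i$ for $i=1,\ldots,d$. *)

theory Defs
  imports "HOL-Analysis.Analysis" "HOL-Algebra.Algebraic_Closure_Type"
begin

section \<open>Number fields\<close>

definition number_field :: "'k::field_char_0 itself \<Rightarrow> bool" where
  "number_field _ \<longleftrightarrow>
    (\<exists>B. finite_dimensional_vector_space (\<lambda>(q::rat) (x::'k). of_rat q * x) B)"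

section \<open>Formal series in the variables and their logarithms\<close>

text \<open>
  An element \<open>g\<close> is the formal sum of the terms \<open>g \<alpha> m * x\<^sup>\<alpha> * (log x)\<^sup>m\<close>, where
  \<open>\<alpha>\<close> ranges over all integer exponents and \<open>m\<close> over all natural ones; the \<open>x\<^sub>i\<close> and the
  \<open>log x\<^sub>i\<close> are independent symbols. The index type \<open>'d\<close> numbers the variables.
\<close>

type_synonym ('k, 'd) log_series = "('d \<Rightarrow> int) \<Rightarrow> ('d \<Rightarrow> nat) \<Rightarrow> 'k"

definition var_mult :: "'d \<Rightarrow> ('k, 'd) log_series \<Rightarrow> ('k, 'd) log_series" where
  "var_mult i g = (\<lambda>\<alpha> m. g (\<alpha>(i := \<alpha> i - 1)) m)"

text \<open>
  The partial derivative maps \<open>x\<^sub>i\<^sup>a (log x\<^sub>i)\<^sup>n\<close> to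
  \<open>a x\<^sub>i\<^sup>a\<^sup>-\<^sup>1 (log x\<^sub>i)\<^sup>n + n x\<^sub>i\<^sup>a\<^sup>-\<^sup>1 (log x\<^sub>i)\<^sup>n\<^sup>-\<^sup>1\<close>; below is the resulting coefficient
  of a given monomial.
\<close>

definition var_deriv :: "'d \<Rightarrow> ('k::comm_ring_1, 'd) log_series \<Rightarrow> ('k, 'd) log_series" where
  "var_deriv i g = (\<lambda>\<alpha> m.
     of_int (\<alpha> i + 1) * g (\<alpha>(i := \<alpha> i + 1)) m
   + of_nat (m i + 1) * g (\<alpha>(i := \<alpha> i + 1)) (m(i := m i + 1)))"

section \<open>The Weyl algebra\<close>

text \<open>
  The algebra is given by generators and relations: expressions in the scalars, the \<open>x\<^sub>i\<close> and
  the \<open>\<partial>\<^sub>i\<close>, modulo the congruence generated by the axioms of an algebra over the coefficient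
  ring and the Weyl relations.
\<close>

datatype ('k, 'd) wexp =
    WScal 'k | WX 'd | WD 'd
  | WPlus "('k, 'd) wexp" "('k, 'd) wexp"
  | WTimes "('k, 'd) wexp" "('k, 'd) wexp"

inductive weyl_eq :: "('k::comm_ring_1, 'd) wexp \<Rightarrow> ('k, 'd) wexp \<Rightarrow> bool" where
  w_refl: "weyl_eq a a"
| w_sym: "weyl_eq a b \<Longrightarrow> weyl_eq b a"
| w_trans: "weyl_eq a b \<Longrightarrow> weyl_eq b c \<Longrightarrow> weyl_eq a c"
| w_plus_cong: "weyl_eq a a' \<Longrightarrow> weyl_eq b b' \<Longrightarrow> weyl_eq (WPlus a b) (WPlus a' b')"
| w_times_cong: "weyl_eq a a' \<Longrightarrow> weyl_eq b b' \<Longrightarrow> weyl_eq (WTimes a b) (WTimes a' b')"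
| w_plus_assoc: "weyl_eq (WPlus (WPlus a b) c) (WPlus a (WPlus b c))"
| w_plus_comm: "weyl_eq (WPlus a b) (WPlus b a)"
| w_plus_zero: "weyl_eq (WPlus (WScal 0) a) a"
| w_plus_neg: "weyl_eq (WPlus (WTimes (WScal (-1)) a) a) (WScal 0)"
| w_times_assoc: "weyl_eq (WTimes (WTimes a b) c) (WTimes a (WTimes b c))"
| w_one_times: "weyl_eq (WTimes (WScal 1) a) a"
| w_times_one: "weyl_eq (WTimes a (WScal 1)) a"
| w_distrib_right: "weyl_eq (WTimes (WPlus a b) c) (WPlus (WTimes a c) (WTimes b c))"
| w_distrib_left: "weyl_eq (WTimes a (WPlus b c)) (WPlus (WTimes a b) (WTimes a c))"
| w_scal_plus: "weyl_eq (WScal (r + s)) (WPlus (WScal r) (WScal s))"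
| w_scal_times: "weyl_eq (WScal (r * s)) (WTimes (WScal r) (WScal s))"
| w_scal_central: "weyl_eq (WTimes (WScal r) a) (WTimes a (WScal r))"
| w_X_comm: "weyl_eq (WTimes (WX i) (WX j)) (WTimes (WX j) (WX i))"
| w_D_comm: "weyl_eq (WTimes (WD i) (WD j)) (WTimes (WD j) (WD i))"
| w_D_X: "weyl_eq (WTimes (WD i) (WX j))
          (WPlus (WTimes (WX j) (WD i)) (WScal (if i = j then 1 else 0)))"

quotient_type (overloaded) ('k, 'd) weyl = "('k::comm_ring_1, 'd) wexp" / weyl_eq
  by (rule equivpI)
     (auto simp: reflp_def symp_def transp_def intro: weyl_eq.w_refl weyl_eq.w_sym weyl_eq.w_trans)

lift_definition weyl_scal :: "'k::comm_ring_1 \<Rightarrow> ('k, 'd) weyl" is WScal .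
lift_definition weyl_X :: "'d \<Rightarrow> ('k::comm_ring_1, 'd) weyl" is WX .
lift_definition weyl_D :: "'d \<Rightarrow> ('k::comm_ring_1, 'd) weyl" is WD .

primrec wexp_act :: "('k::comm_ring_1, 'd) wexp \<Rightarrow> ('k, 'd) log_series \<Rightarrow> ('k, 'd) log_series"
where
  "wexp_act (WScal c) g = (\<lambda>\<alpha> m. c * g \<alpha> m)"
| "wexp_act (WX i) g = var_mult i g"
| "wexp_act (WD i) g = var_deriv i g"
| "wexp_act (WPlus a b) g = (\<lambda>\<alpha> m. wexp_act a g \<alpha> m + wexp_act b g \<alpha> m)"
| "wexp_act (WTimes a b) g = wexp_act a (wexp_act b g)"

lemma wexp_act_add:
  "wexp_act a (\<lambda>\<alpha> m. g \<alpha> m + h \<alpha> m) = (\<lambda>\<alpha> m. wexp_act a g \<alpha> m + wexp_act a h \<alpha> m)"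
  by (induction a arbitrary: g h) (simp_all add: var_mult_def var_deriv_def algebra_simps)

lemma wexp_act_scale:
  "wexp_act a (\<lambda>\<alpha> m. c * g \<alpha> m) = (\<lambda>\<alpha> m. c * wexp_act a g \<alpha> m)"
  by (induction a arbitrary: g) (simp_all add: var_mult_def var_deriv_def algebra_simps)

lemma var_deriv_var_mult:
  "var_deriv i (var_mult j g) =
     (\<lambda>\<alpha> m. var_mult j (var_deriv i g) \<alpha> m + (if i = j then 1 else 0) * g \<alpha> m)"
  by (cases "i = j") (simp_all add: var_mult_def var_deriv_def fun_upd_twist[of i j] algebra_simps)

lemma weyl_eq_act: "weyl_eq a b \<Longrightarrow> wexp_act a g = wexp_act b g"
proof (induction arbitrary: g rule: weyl_eq.induct)
  case (w_X_comm i j)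
  then show ?case
    by (cases "i = j") (simp_all add: var_mult_def fun_upd_twist[of i j])
next
  case (w_D_comm i j)
  then show ?case
    by (cases "i = j") (simp_all add: var_deriv_def fun_upd_twist[of i j] algebra_simps)
next
  case (w_D_X i j)
  then show ?case by (simp add: var_deriv_var_mult)
qed (simp_all add: wexp_act_add wexp_act_scale algebra_simps)

lift_definition weyl_act ::
  "('k::comm_ring_1, 'd) weyl \<Rightarrow> ('k, 'd) log_series \<Rightarrow> ('k, 'd) log_series" is wexp_act
  by (rule ext) (rule weyl_eq_act)

instantiation weyl :: (comm_ring_1, type) ring_1
begin

lift_definition zero_weyl :: "('a, 'b) weyl" is "WScal 0" .
lift_definition one_weyl :: "('a, 'b) weyl" is "WScal 1" .
lift_definition plus_weyl :: "('a, 'b) weyl \<Rightarrow> ('a, 'b) weyl \<Rightarrow> ('a, 'b) weyl" is WPlus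
  by (rule weyl_eq.w_plus_cong)
lift_definition times_weyl :: "('a, 'b) weyl \<Rightarrow> ('a, 'b) weyl \<Rightarrow> ('a, 'b) weyl" is WTimes
  by (rule weyl_eq.w_times_cong)
lift_definition uminus_weyl :: "('a, 'b) weyl \<Rightarrow> ('a, 'b) weyl" is "WTimes (WScal (-1))"
  by (rule weyl_eq.w_times_cong[OF weyl_eq.w_refl])
definition minus_weyl :: "('a, 'b) weyl \<Rightarrow> ('a, 'b) weyl \<Rightarrow> ('a, 'b) weyl" where
  "minus_weyl a b = a + - b"

instance
proof
  fix a b c :: "('a, 'b) weyl"
  show "a + b + c = a + (b + c)" by transfer (rule weyl_eq.w_plus_assoc)
  show "a + b = b + a" by transfer (rule weyl_eq.w_plus_comm)
  show "0 + a = a" by transfer (rule weyl_eq.w_plus_zero)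
  show "- a + a = 0" by transfer (rule weyl_eq.w_plus_neg)
  show "a - b = a + - b" by (simp add: minus_weyl_def)
  show "a * b * c = a * (b * c)" by transfer (rule weyl_eq.w_times_assoc)
  show "1 * a = a" by transfer (rule weyl_eq.w_one_times)
  show "a * 1 = a" by transfer (rule weyl_eq.w_times_one)
  show "(a + b) * c = a * c + b * c" by transfer (rule weyl_eq.w_distrib_right)
  show "a * (b + c) = a * b + a * c" by transfer (rule weyl_eq.w_distrib_left)
  show "(0 :: ('a, 'b) weyl) \<noteq> 1"
  proof
    assume "(0 :: ('a, 'b) weyl) = 1"
    then have "weyl_eq (WScal 0 :: ('a, 'b) wexp) (WScal 1)" by transfer
    from weyl_eq_act[OF this, of "\<lambda>_ _. 1"] show False by (simp add: fun_eq_iff)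
  qed
qed

end

lemma weyl_scal_0: "weyl_scal 0 = 0" by transfer (rule weyl_eq.w_refl)
lemma weyl_scal_1: "weyl_scal 1 = 1" by transfer (rule weyl_eq.w_refl)
lemma weyl_scal_add: "weyl_scal (r + s) = weyl_scal r + weyl_scal s"
  by transfer (rule weyl_eq.w_scal_plus)
lemma weyl_scal_mult: "weyl_scal (r * s) = weyl_scal r * weyl_scal s"
  by transfer (rule weyl_eq.w_scal_times)
lemma weyl_scal_central: "weyl_scal r * a = a * weyl_scal r"
  by transfer (rule weyl_eq.w_scal_central)
lemma weyl_scal_left: "a * (weyl_scal r * b) = weyl_scal r * (a * b)"
  by (metis mult.assoc weyl_scal_central)
lemma weyl_scal_uminus: "weyl_scal (- r) = - weyl_scal r"
  by (metis add.left_inverse add_eq_0_iff2 weyl_scal_0 weyl_scal_add)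
lemma weyl_X_comm: "weyl_X i * weyl_X j = weyl_X j * weyl_X i"
  by transfer (rule weyl_eq.w_X_comm)
lemma weyl_D_comm: "weyl_D i * weyl_D j = weyl_D j * weyl_D i"
  by transfer (rule weyl_eq.w_D_comm)
lemma weyl_D_X: "weyl_D i * weyl_X j = weyl_X j * weyl_D i + (if i = j then 1 else 0)"
proof -
  have "weyl_D i * weyl_X j = weyl_X j * weyl_D i + weyl_scal (if i = j then 1 else 0)"
    by transfer (rule weyl_eq.w_D_X)
  then show ?thesis by (auto simp: weyl_scal_0 weyl_scal_1)
qed

lemma weyl_act_scal: "weyl_act (weyl_scal c) g = (\<lambda>\<alpha> m. c * g \<alpha> m)"
  by transfer simp
lemma weyl_act_X: "weyl_act (weyl_X i) g = var_mult i g"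
  by transfer simp
lemma weyl_act_D: "weyl_act (weyl_D i) g = var_deriv i g"
  by transfer simp
lemma weyl_act_add: "weyl_act (a + b) g = (\<lambda>\<alpha> m. weyl_act a g \<alpha> m + weyl_act b g \<alpha> m)"
  by transfer simp
lemma weyl_act_mult: "weyl_act (a * b) g = weyl_act a (weyl_act b g)"
  by transfer simp

lemma weyl_induct [case_names scal X D plus times]:
  fixes P :: "('k::comm_ring_1, 'd) weyl \<Rightarrow> bool"
  assumes "\<And>c. P (weyl_scal c)" "\<And>i. P (weyl_X i)" "\<And>i. P (weyl_D i)"
    and "\<And>a b. P a \<Longrightarrow> P b \<Longrightarrow> P (a + b)" "\<And>a b. P a \<Longrightarrow> P b \<Longrightarrow> P (a * b)"
  shows "P a"
proof -
  have "P (abs_weyl e)" for e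
    by (induction e)
       (use assms in \<open>auto simp: weyl_scal.abs_eq weyl_X.abs_eq weyl_D.abs_eq
          plus_weyl.abs_eq[symmetric] times_weyl.abs_eq[symmetric]\<close>)
  then show ?thesis by (metis Quotient3_abs_rep Quotient3_weyl)
qed

definition weyl_solution :: "('k::comm_ring_1, 'd) weyl \<Rightarrow> ('k, 'd) log_series \<Rightarrow> bool" where
  "weyl_solution \<phi> g \<longleftrightarrow> weyl_act \<phi> g = (\<lambda>_ _. 0)"

section \<open>The Fourier automorphism\<close>

definition weyl_automorphism :: "(('k::comm_ring_1, 'd) weyl \<Rightarrow> ('k, 'd) weyl) \<Rightarrow> bool" where
  "weyl_automorphism F \<longleftrightarrow> bij F
     \<and> (\<forall>a b. F (a + b) = F a + F b) \<and> (\<forall>a b. F (a * b) = F a * F b)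
     \<and> (\<forall>c. F (weyl_scal c) = weyl_scal c)"

definition is_fourier ::
  "('d \<Rightarrow> 'k::field) \<Rightarrow> (('k, 'd) weyl \<Rightarrow> ('k, 'd) weyl) \<Rightarrow> bool" where
  "is_fourier \<tau> F \<longleftrightarrow> weyl_automorphism F
     \<and> (\<forall>i. F (weyl_X i) = weyl_scal (- (1 / \<tau> i)) * weyl_D i)
     \<and> (\<forall>i. F (weyl_D i) = weyl_scal (\<tau> i) * weyl_X i)"

text \<open>Meaningful when all \<open>\<tau> i\<close> are nonzero; see \<open>fourier_unique_existence\<close>.\<close>

definition fourier :: "('d \<Rightarrow> 'k::field) \<Rightarrow> ('k, 'd) weyl \<Rightarrow> ('k, 'd) weyl" where
  "fourier \<tau> = (THE F. is_fourier \<tau> F)"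

primrec wexp_fourier :: "('d \<Rightarrow> 'k::field) \<Rightarrow> ('k, 'd) wexp \<Rightarrow> ('k, 'd) weyl" where
  "wexp_fourier \<tau> (WScal c) = weyl_scal c"
| "wexp_fourier \<tau> (WX i) = weyl_scal (- (1 / \<tau> i)) * weyl_D i"
| "wexp_fourier \<tau> (WD i) = weyl_scal (\<tau> i) * weyl_X i"
| "wexp_fourier \<tau> (WPlus a b) = wexp_fourier \<tau> a + wexp_fourier \<tau> b"
| "wexp_fourier \<tau> (WTimes a b) = wexp_fourier \<tau> a * wexp_fourier \<tau> b"

lemma weyl_scal_pair:
  "(weyl_scal r * a) * (weyl_scal s * b) = weyl_scal (r * s) * (a * b)"
  by (metis (no_types) mult.assoc weyl_scal_left weyl_scal_mult)

lemma wexp_fourier_cong: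
  fixes a b :: "('k::field, 'd) wexp"
  assumes "\<And>i. \<tau> i \<noteq> 0"
  shows "weyl_eq a b \<Longrightarrow> wexp_fourier \<tau> a = wexp_fourier \<tau> b"
proof (induction rule: weyl_eq.induct)
  case (w_X_comm i j)
  then show ?case by (simp add: weyl_scal_pair weyl_D_comm mult.commute)
next
  case (w_D_comm i j)
  then show ?case by (simp add: weyl_scal_pair weyl_X_comm mult.commute)
next
  case (w_D_X i j)
  let ?s = "weyl_scal (- (\<tau> i / \<tau> j)) :: ('k, 'd) weyl"
  have 1: "(weyl_scal (\<tau> i) * weyl_X i) * (weyl_scal (- (1 / \<tau> j)) * weyl_D j)
      = ?s * (weyl_X i * weyl_D j)"
    by (simp add: weyl_scal_pair)
  have 2: "(weyl_scal (- (1 / \<tau> j)) * weyl_D j) * (weyl_scal (\<tau> i) * weyl_X i)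
      = ?s * (weyl_X i * weyl_D j) + ?s * (if i = j then 1 else 0)"
  proof -
    have "weyl_D j * weyl_X i = weyl_X i * weyl_D j + (if i = j then 1 else 0 :: ('k, 'd) weyl)"
      by (simp add: weyl_D_X)
    moreover have "- (1 / \<tau> j) * \<tau> i = - (\<tau> i / \<tau> j)" by simp
    ultimately show ?thesis by (simp only: weyl_scal_pair distrib_left)
  qed
  have 3: "?s * (if i = j then 1 else 0) + weyl_scal (if i = j then 1 else 0) = 0"
    using assms[of j] by (auto simp: weyl_scal_0 weyl_scal_1 weyl_scal_uminus)
  show ?case unfolding wexp_fourier.simps 1 2 add.assoc 3 by simp
next
  case (w_scal_central r a)
  show ?case by (simp add: weyl_scal_central)
next
  case (w_plus_neg a)
  show ?case by (simp add: weyl_scal_0 weyl_scal_1 weyl_scal_uminus)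
qed (simp_all add: weyl_scal_0 weyl_scal_1 weyl_scal_add weyl_scal_mult
       add.assoc add.commute mult.assoc distrib_left distrib_right)

lemma fourier_hom_ex:
  assumes "\<And>i. \<tau> i \<noteq> 0"
  shows "\<exists>F :: ('k::field, 'd) weyl \<Rightarrow> ('k, 'd) weyl.
    (\<forall>a b. F (a + b) = F a + F b) \<and> (\<forall>a b. F (a * b) = F a * F b)
    \<and> (\<forall>c. F (weyl_scal c) = weyl_scal c)
    \<and> (\<forall>i. F (weyl_X i) = weyl_scal (- (1 / \<tau> i)) * weyl_D i)
    \<and> (\<forall>i. F (weyl_D i) = weyl_scal (\<tau> i) * weyl_X i)"
proof (intro exI conjI allI)
  let ?F = "\<lambda>a. wexp_fourier \<tau> (rep_weyl a)"
  have F: "?F (abs_weyl e) = wexp_fourier \<tau> e" for e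
    by (rule wexp_fourier_cong[OF assms]) (metis Quotient3_rep_abs Quotient3_weyl weyl_eq.w_refl)
  have abs: "\<exists>e. a = abs_weyl e" for a :: "('k, 'd) weyl"
    by (metis Quotient3_abs_rep Quotient3_weyl)
  fix a b :: "('k, 'd) weyl"
  obtain x y where [simp]: "a = abs_weyl x" "b = abs_weyl y" using abs by metis
  show "?F (a + b) = ?F a + ?F b" "?F (a * b) = ?F a * ?F b"
    by (simp_all add: plus_weyl.abs_eq times_weyl.abs_eq F)
  show "?F (weyl_scal c) = weyl_scal c" for c by (simp add: weyl_scal.abs_eq F)
  show "?F (weyl_X i) = weyl_scal (- (1 / \<tau> i)) * weyl_D i" for i
    by (simp add: weyl_X.abs_eq F)
  show "?F (weyl_D i) = weyl_scal (\<tau> i) * weyl_X i" for i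
    by (simp add: weyl_D.abs_eq F)
qed

theorem fourier_unique_existence:
  assumes "\<And>i. \<tau> i \<noteq> 0"
  shows "\<exists>!F :: ('k::field, 'd) weyl \<Rightarrow> ('k, 'd) weyl. is_fourier \<tau> F"
proof (rule ex_ex1I)
  obtain F :: "('k, 'd) weyl \<Rightarrow> ('k, 'd) weyl" where F:
    "\<And>a b. F (a + b) = F a + F b" "\<And>a b. F (a * b) = F a * F b"
    "\<And>c. F (weyl_scal c) = weyl_scal c"
    "\<And>i. F (weyl_X i) = weyl_scal (- (1 / \<tau> i)) * weyl_D i"
    "\<And>i. F (weyl_D i) = weyl_scal (\<tau> i) * weyl_X i"
    using fourier_hom_ex[of \<tau>, OF assms] by blast
  have neg: "\<And>i. - \<tau> i \<noteq> 0" using assms by simp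
  obtain G :: "('k, 'd) weyl \<Rightarrow> ('k, 'd) weyl" where G:
    "\<And>a b. G (a + b) = G a + G b" "\<And>a b. G (a * b) = G a * G b"
    "\<And>c. G (weyl_scal c) = weyl_scal c"
    "\<And>i. G (weyl_X i) = weyl_scal (- (1 / - \<tau> i)) * weyl_D i"
    "\<And>i. G (weyl_D i) = weyl_scal (- \<tau> i) * weyl_X i"
    using fourier_hom_ex[of "\<lambda>i. - \<tau> i", OF neg] by blast
  have inv: "weyl_scal r * (weyl_scal s * a) = a" if "r * s = 1" for r s and a :: "('k, 'd) weyl"
    by (metis mult.assoc mult_1 that weyl_scal_1 weyl_scal_mult)
  have "G (F a) = a" for a
  proof (induction a rule: weyl_induct)
    case (X i)
    show ?case unfolding F G by (rule inv) (use assms[of i] in simp)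
  next
    case (D i)
    show ?case unfolding F G by (rule inv) (use assms[of i] in simp)
  qed (simp_all add: F G)
  moreover have "F (G a) = a" for a
  proof (induction a rule: weyl_induct)
    case (X i)
    show ?case unfolding F G by (rule inv) (use assms[of i] in simp)
  next
    case (D i)
    show ?case unfolding F G by (rule inv) (use assms[of i] in simp)
  qed (simp_all add: F G)
  ultimately have "bij F" by (intro o_bij[of G]) (simp_all add: fun_eq_iff)
  with F show "\<exists>F :: ('k, 'd) weyl \<Rightarrow> ('k, 'd) weyl. is_fourier \<tau> F"
    unfolding is_fourier_def weyl_automorphism_def by blast
next
  fix F G :: "('k, 'd) weyl \<Rightarrow> ('k, 'd) weyl"
  assume FG: "is_fourier \<tau> F" "is_fourier \<tau> G"
  show "F = G"
  proof
    show "F a = G a" for a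
      by (induction a rule: weyl_induct)
         (use FG in \<open>simp_all add: is_fourier_def weyl_automorphism_def\<close>)
  qed
qed

section \<open>Matrix powers and the Laplace transform\<close>

definition eigenvalues_ac :: "'k::field^'n^'n \<Rightarrow> 'k alg_closure set" where
  "eigenvalues_ac A = {\<mu>. \<exists>v. v \<noteq> 0 \<and> map_matrix to_ac A *v v = \<mu> *s v}"

text \<open>Multiplication of square matrices is \<open>**\<close>, and \<open>mat c\<close> is \<open>c\<close> times the identity.\<close>

definition mat_prod_list :: "('k::semiring_1^'n^'n) list \<Rightarrow> 'k^'n^'n" where
  "mat_prod_list As = foldr (**) As (mat 1)"

definition mat_power :: "'k::semiring_1^'n^'n \<Rightarrow> nat \<Rightarrow> 'k^'n^'n" where
  "mat_power A n = mat_prod_list (replicate n A)"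

text \<open>The product of a family of matrices in the order of the indices.\<close>

definition mat_prod :: "('d::{finite,linorder} \<Rightarrow> 'k::semiring_1^'n^'n) \<Rightarrow> 'k^'n^'n" where
  "mat_prod A = mat_prod_list (map A (sorted_list_of_set UNIV))"

text \<open>\<open>xpow_coeff A n\<close> is the coefficient of \<open>(log x)\<^sup>n\<close> in \<open>x\<^sup>A = exp (A log x)\<close>.\<close>

definition xpow_coeff :: "'k::field_char_0^'n^'n \<Rightarrow> nat \<Rightarrow> 'k^'n^'n" where
  "xpow_coeff A n = mat (1 / fact n) ** mat_power A n"

text \<open>The union of the set of nonnegative and the set of nonpositive exponents.\<close>

definition orthants :: "('d \<Rightarrow> int) set" where
  "orthants = {\<alpha>. \<forall>i. 0 \<le> \<alpha> i} \<union> {\<alpha>. \<forall>i. \<alpha> i \<le> 0}"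

text \<open>
  The \<open>j\<close>-th entry of \<open>Y(x) x\<^sup>\<Lambda>\<close>, where the row vector \<open>Y \<alpha>\<close> is the coefficient of \<open>x\<^sup>\<alpha>\<close>
  in \<open>Y(x)\<close>. The coefficient of \<open>(log x)\<^sup>m\<close> in \<open>x\<^sup>\<Lambda>\<close> is the product of those of the
  \<open>(log x\<^sub>i)\<close>-powers in the factors.
\<close>

definition series_xpow ::
  "('d::{finite,linorder} \<Rightarrow> 'k::field_char_0^'n^'n) \<Rightarrow> (('d \<Rightarrow> int) \<Rightarrow> 'k^'n)
    \<Rightarrow> 'n \<Rightarrow> ('k, 'd) log_series" where
  "series_xpow \<Lambda> Y j = (\<lambda>\<alpha> m. (Y \<alpha> v* mat_prod (\<lambda>i. xpow_coeff (\<Lambda> i) (m i))) $ j)"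

definition laplace_coeff :: "'k::field^'n^'n \<Rightarrow> 'k \<Rightarrow> int \<Rightarrow> 'k^'n^'n" where
  "laplace_coeff \<Lambda> \<tau> n = mat (\<tau> powi (- n)) **
     (if n \<ge> 0
      then mat_prod_list (map (\<lambda>k. \<Lambda> + mat (of_int k)) (rev [1..n]))
      else mat_prod_list (map (\<lambda>k. matrix_inv (\<Lambda> + mat (of_int k))) (rev [n+1..0])))"

text \<open>
  The \<open>j\<close>-th entry of the formal Laplace transform of \<open>Y(x) x\<^sup>\<Lambda>\<close>. Since \<open>x\<^sub>i\<close> and \<open>log x\<^sub>i\<close> are
  independent, the power of \<open>x\<^sub>i\<close> with matrix exponent \<open>-\<Lambda>\<^sub>i - (\<alpha>\<^sub>i + 1)\<close> denotes the monomial
  with integer exponent \<open>-(\<alpha>\<^sub>i + 1)\<close> times \<open>x\<^sub>i\<close> to the \<open>-\<Lambda>\<^sub>i\<close>. The sum runs over the \<open>\<alpha>\<close>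
  contributing to \<open>x\<^sup>\<beta>\<close>, of which there is at most one.
\<close>

definition laplace ::
  "('d::{finite,linorder} \<Rightarrow> 'k::field_char_0) \<Rightarrow> ('d \<Rightarrow> 'k^'n^'n) \<Rightarrow> (('d \<Rightarrow> int) \<Rightarrow> 'k^'n)
    \<Rightarrow> 'n \<Rightarrow> ('k, 'd) log_series" where
  "laplace \<tau> \<Lambda> Y j = (\<lambda>\<beta> m.
     \<Sum>\<alpha>\<in>{\<alpha>\<in>orthants. \<forall>i. \<beta> i = - (\<alpha> i + 1)}.
       (Y \<alpha> v* mat_prod (\<lambda>i. laplace_coeff (\<Lambda> i) (\<tau> i) (\<alpha> i) ** xpow_coeff (- \<Lambda> i) (m i))) $ j)"

end

theory Submission
  imports Defs
begin

text \<open>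
  As in the classical case, the transform turns multiplication by \<open>x\<^sub>i\<close> into
  \<open>- (1 / \<tau>\<^sub>i) \<partial>\<^sub>i\<close> and \<open>\<partial>\<^sub>i\<close> into multiplication by \<open>\<tau>\<^sub>i x\<^sub>i\<close>. Both rules express the
  recursion \<open>C(n + 1) = \<tau>\<^sup>-\<^sup>1 (\<Lambda> + n + 1) C(n)\<close> (lemma \<open>laplace_coeff_succ\<close>), the matrix form of
  \<open>\<Gamma>(z + 1) = z \<Gamma>(z)\<close>, because \<open>\<Lambda> + n + 1\<close> is the factor that comes out when
  \<open>x\<close> to the power \<open>\<Lambda> + n + 1\<close> is differentiated, and \<open>- (\<Lambda> + n + 1)\<close> the one that comes out
  of the transformed power, whose exponent is \<open>- \<Lambda> - (n + 1)\<close>. That the eigenvalues of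
  \<open>\<Lambda>\<close> avoid the integers makes all the \<open>\<Lambda> + n\<close> invertible, which the recursion needs for
  negative \<open>n\<close>.

  Two points need care. For several variables the set of exponents
  \<open>\<nat>\<^sup>d \<union> (-\<nat>)\<^sup>d\<close> is not stable under the shifts by a unit vector, so an intermediate
  series in the evaluation of \<open>\<phi> f\<close> need not lie in the domain of the transform. The same
  formula makes sense for arbitrary integer exponents, and the exchange rules are proved for this
  extension (\<open>full_laplace_coeff_shift\<close>, \<open>full_laplace_coeff_deriv\<close>); the extension agrees
  with the given transform when the coefficients vanish outside
  \<open>\<nat>\<^sup>d \<union> (-\<nat>)\<^sup>d\<close>. Moreover the transform acts on the rows \<open>Y\<close>
  and not on the series \<open>Y(x) x\<^sup>\<Lambda>\<close>. One therefore follows the coefficient rows: every \<open>\<phi>\<close> sends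
  the row \<open>Y\<close> to a row \<open>Z\<close> that describes at once \<open>\<phi>\<close> applied to the series and the Fourier
  image of \<open>\<phi>\<close> applied to its transform (\<open>weyl_act_intertwined\<close>). If \<open>\<phi>\<close> kills the series,
  then \<open>Z = 0\<close>, since the part of \<open>Z(x) x\<^sup>\<Lambda>\<close> free of logarithms is \<open>Z\<close> itself, and so the
  transform of the series is killed too.
\<close>

section \<open>Matrix algebra\<close>

lemma mat_mult_left: "mat c ** A = (\<chi> i j. c * A $ i $ j)"
  for A :: "'k::semiring_1^'n^'m"
  by (simp add: matrix_matrix_mult_def mat_def if_distrib if_distribR vec_eq_iff cong: if_cong)

lemma mat_central: "mat c ** A = A ** mat c"
  for A :: "'k::comm_ring_1^'n^'n"
  by (simp add: matrix_matrix_mult_def mat_def if_distrib if_distribR vec_eq_iff mult.commute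
      cong: if_cong)

lemma mat_mult_mat: "mat c ** mat d = (mat (c * d) :: 'k::semiring_1^'n^'n)"
  unfolding mat_mult_left by (auto simp: mat_def vec_eq_iff)

lemma vector_mat_mult: "v v* (mat c ** A) = c *s (v v* A)"
  for v :: "'k::comm_ring_1^'n"
  by (simp add: mat_mult_left vector_matrix_mult_def vec_eq_iff sum_distrib_left mult_ac)

lemma mat_vector_mult: "mat c *v v = c *s v"
  by (simp add: matrix_vector_mult_def mat_def if_distrib if_distribR vec_eq_iff cong: if_cong)

lemma commute_mult:
  fixes A B C :: "'k::semiring_1^'n^'n"
  assumes "A ** B = B ** A" "A ** C = C ** A"
  shows "A ** (B ** C) = (B ** C) ** A"
  using assms by (metis matrix_mul_assoc)

lemma commute_add:
  fixes A B C :: "'k::semiring_1^'n^'n"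
  assumes "A ** B = B ** A" "A ** C = C ** A"
  shows "A ** (B + C) = (B + C) ** A"
  using assms
  by (simp add: matrix_matrix_mult_def vec_eq_iff distrib_left distrib_right sum.distrib)

lemma commute_minus:
  fixes A B :: "'k::ring_1^'n^'n"
  assumes "A ** B = B ** A"
  shows "A ** (- B) = (- B) ** A"
  using assms by (simp add: matrix_matrix_mult_def vec_eq_iff sum_negf)

lemma matrix_inv_inverse:
  fixes A :: "'k::semiring_1^'n^'n"
  assumes "invertible A"
  shows "A ** matrix_inv A = mat 1" "matrix_inv A ** A = mat 1"
  using someI_ex[OF assms[unfolded invertible_def]] by (simp_all add: matrix_inv_def)

lemma commute_matrix_inv:
  fixes A B :: "'k::semiring_1^'n^'n"
  assumes "invertible B" "A ** B = B ** A"
  shows "A ** matrix_inv B = matrix_inv B ** A"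
proof -
  have "A ** matrix_inv B = matrix_inv B ** (B ** A) ** matrix_inv B"
    by (simp add: matrix_mul_assoc matrix_inv_inverse(2)[OF assms(1)])
  also have "\<dots> = matrix_inv B ** A ** (B ** matrix_inv B)"
    by (simp add: assms(2)[symmetric] matrix_mul_assoc)
  finally show ?thesis
    by (simp add: matrix_inv_inverse(1)[OF assms(1)])
qed

lemma mat_prod_list_simps [simp]:
  "mat_prod_list [] = mat 1"
  "mat_prod_list (A # As) = A ** mat_prod_list As"
  by (simp_all add: mat_prod_list_def)

lemma mat_prod_list_snoc [simp]: "mat_prod_list (As @ [A]) = mat_prod_list As ** A"
  by (induction As) (simp_all add: matrix_mul_assoc)

lemma commute_mat_prod_list:
  fixes A :: "'k::semiring_1^'n^'n"
  assumes "\<And>B. B \<in> set Bs \<Longrightarrow> A ** B = B ** A"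
  shows "A ** mat_prod_list Bs = mat_prod_list Bs ** A"
  using assms by (induction Bs) (simp_all add: commute_mult)

lemma mat_prod_list_upd:
  fixes A A' :: "'d \<Rightarrow> 'k::semiring_1^'n^'n"
  assumes "distinct is" "i \<in> set is" "A' i = B ** A i"
    and "\<And>k. k \<noteq> i \<Longrightarrow> A' k = A k" "\<And>k. k \<noteq> i \<Longrightarrow> B ** A k = A k ** B"
  shows "mat_prod_list (map A' is) = B ** mat_prod_list (map A is)"
  using assms(1,2)
proof (induction "is")
  case (Cons k ks)
  show ?case
  proof (cases "k = i")
    case True
    then have same: "map A' ks = map A ks"
      by (intro map_cong refl assms(4)) (use Cons.prems in auto)
    show ?thesis
      by (simp only: list.map mat_prod_list_simps True assms(3) same matrix_mul_assoc)
  next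
    case False
    then show ?thesis
      using Cons assms(4,5)[of k] by (simp add: matrix_mul_assoc)
  qed
qed simp

text \<open>
  The product of a family of matrices is taken in a fixed order; a factor acquired by its \<open>i\<close>-th
  member can be pulled to the front because it commutes with the members that precede it.
\<close>

lemma mat_prod_upd:
  fixes A A' :: "'d::{finite,linorder} \<Rightarrow> 'k::semiring_1^'n^'n"
  assumes "A' i = B ** A i"
    and "\<And>k. k \<noteq> i \<Longrightarrow> A' k = A k" "\<And>k. k \<noteq> i \<Longrightarrow> B ** A k = A k ** B"
  shows "mat_prod A' = B ** mat_prod A"
  unfolding mat_prod_def by (rule mat_prod_list_upd) (use assms in auto)

lemma mat_prod_one: "mat_prod (\<lambda>_. mat 1) = mat 1"
proof -
  have "mat_prod_list (map (\<lambda>_. mat 1) xs) = (mat 1 :: 'a^'b^'b)" for xs :: "'c list"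
    by (induction xs) simp_all
  then show ?thesis by (simp add: mat_prod_def)
qed

section \<open>Coefficients of matrix powers and of the Laplace transform\<close>

lemma commute_xpow_coeff:
  fixes A B :: "'k::field_char_0^'n^'n"
  assumes "A ** B = B ** A"
  shows "A ** xpow_coeff B n = xpow_coeff B n ** A"
  unfolding xpow_coeff_def mat_power_def
  by (intro commute_mult mat_central[symmetric] commute_mat_prod_list) (simp add: assms)

lemma xpow_coeff_0: "xpow_coeff A 0 = mat 1"
  by (simp add: xpow_coeff_def mat_power_def)

lemma xpow_coeff_Suc: "xpow_coeff A (Suc n) = mat (1 / of_nat (Suc n)) ** A ** xpow_coeff A n"
proof -
  have "xpow_coeff A (Suc n) = mat (1 / of_nat (Suc n)) ** (mat (1 / fact n) ** A) ** mat_power A n"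
    by (simp add: xpow_coeff_def mat_power_def matrix_mul_assoc mat_mult_mat)
  then show ?thesis
    by (simp add: mat_central[of "1 / fact n" A] xpow_coeff_def matrix_mul_assoc)
qed

lemma commute_laplace_coeff:
  fixes A B :: "'k::field^'n^'n"
  assumes "A ** B = B ** A" "\<And>k. invertible (B + mat (of_int k))"
  shows "A ** laplace_coeff B t n = laplace_coeff B t n ** A"
proof -
  have "A ** (B + mat (of_int k)) = (B + mat (of_int k)) ** A" for k
    by (intro commute_add assms(1) mat_central[symmetric])
  then show ?thesis
    unfolding laplace_coeff_def
    by (auto intro!: commute_mult mat_central[symmetric] commute_mat_prod_list
        commute_matrix_inv assms(2))
qed

text \<open>
  This is the functional equation of the Gamma function: \<open>C(n)\<close> plays the role of
  \<open>\<tau>\<^sup>-\<^sup>n \<Gamma>(\<Lambda> + n + 1) / \<Gamma>(\<Lambda> + 1)\<close>. The products of inverses for negative \<open>n\<close>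
  continue the rising products for positive \<open>n\<close> along one and the same recursion.
\<close>

lemma laplace_coeff_succ:
  fixes A :: "'k::field_char_0^'n^'n"
  assumes "t \<noteq> 0" and inv: "\<And>k. invertible (A + mat (of_int k))"
  shows "laplace_coeff A t (n + 1)
    = mat (1 / t) ** (A + mat (of_int (n + 1))) ** laplace_coeff A t n"
proof -
  let ?A = "\<lambda>k. A + mat (of_int k)"
  have scal: "mat (t powi (- (n + 1))) = mat (1 / t) ** (mat (t powi (- n)) :: 'k^'n^'n)"
  proof -
    have "t powi (- (n + 1)) = t powi (- 1 + - n)" by (rule arg_cong) simp
    also have "\<dots> = 1 / t * t powi (- n)"
      using assms(1) by (subst power_int_add) (simp_all add: power_int_minus divide_inverse)
    finally show ?thesis by (simp only: mat_mult_mat)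
  qed
  define P where "P k = (if k \<ge> 0
      then mat_prod_list (map ?A (rev [1..k]))
      else mat_prod_list (map (\<lambda>k. matrix_inv (?A k)) (rev [k+1..0])))" for k
  have P: "laplace_coeff A t k = mat (t powi (- k)) ** P k" for k
    by (simp add: P_def laplace_coeff_def)
  have step: "P (n + 1) = ?A (n + 1) ** P n"
  proof (cases "n \<ge> 0")
    case True
    then have "[1..n + 1] = [1..n] @ [n + 1]" by (simp add: upto_rec2)
    then show ?thesis using True by (simp add: P_def)
  next
    case False
    \<comment> \<open>For \<open>n = - 1\<close> the remaining list is empty and \<open>C(0)\<close> falls under the other branch of
      the definition; both give the identity.\<close>
    then have "[n + 1..0] = (n + 1) # [n + 1 + 1..0]" by (simp add: upto_rec1)
    moreover have "P (n + 1) = mat_prod_list (map (\<lambda>k. matrix_inv (?A k)) (rev [n + 1 + 1..0]))"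
      using False by (cases "n = -1") (simp_all add: P_def)
    ultimately have Pn: "P n = P (n + 1) ** matrix_inv (?A (n + 1))"
      using False by (simp add: P_def)
    \<comment> \<open>The definition places the new inverse last, where it can only cancel after
      commuting \<open>\<Lambda> + n + 1\<close> past the other factors.\<close>
    have comm: "?A (n + 1) ** ?A k = ?A k ** ?A (n + 1)" for k
      by (intro commute_add mat_central[symmetric]) (metis commute_add mat_central)
    have "?A (n + 1) ** P (n + 1) = P (n + 1) ** ?A (n + 1)"
      unfolding P_def
      by (auto intro!: commute_mat_prod_list commute_matrix_inv inv comm simp del: of_int_add)
    then show ?thesis
      by (simp add: Pn matrix_mul_assoc)
        (simp add: matrix_mul_assoc[symmetric] matrix_inv_inverse[OF inv, of "n + 1", simplified])
  qed
  show ?thesis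
    unfolding P step scal
    by (metis mat_central matrix_mul_assoc)
qed

text \<open>
  A singular \<open>\<Lambda> + k\<close> has a kernel vector over the field itself, which exhibits the integer
  \<open>- k\<close> as an eigenvalue of \<open>\<Lambda>\<close>.
\<close>

lemma invertible_add_int:
  fixes A :: "'k::field_char_0^'n^'n"
  assumes "eigenvalues_ac A \<subseteq> to_ac ` (- \<int>)"
  shows "invertible (A + mat (of_int k))"
proof (rule ccontr)
  assume "\<not> invertible (A + mat (of_int k))"
  then obtain v where v: "v \<noteq> 0" "(A + mat (of_int k)) *v v = 0"
    by (metis invertible_left_inverse matrix_left_invertible_ker)
  let ?v = "\<chi> i. to_ac (v $ i)"
  have "(\<Sum>j\<in>UNIV. A $ i $ j * v $ j) = - of_int k * v $ i" for i
  proof -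
    have "((A + mat (of_int k)) *v v) $ i = (\<Sum>j\<in>UNIV. A $ i $ j * v $ j) + of_int k * v $ i"
      by (simp add: matrix_vector_mult_add_rdistrib mat_vector_mult)
        (simp add: matrix_vector_mult_def)
    then show ?thesis using v(2) by (simp add: eq_neg_iff_add_eq_0)
  qed
  then have "(\<Sum>j\<in>UNIV. to_ac (A $ i $ j) * to_ac (v $ j)) = to_ac (- of_int k) * to_ac (v $ i)" for i
    by (simp only: to_ac_mult[symmetric] to_ac_sum[symmetric])
  then have "map_matrix to_ac A *v ?v = to_ac (- of_int k) *s ?v"
    by (simp add: matrix_vector_mult_def vec_eq_iff)
  moreover have "?v \<noteq> 0" using v(1) by (simp add: vec_eq_iff)
  ultimately have "to_ac (- of_int k) \<in> eigenvalues_ac A"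
    unfolding eigenvalues_ac_def by blast
  then have "to_ac (- of_int k :: 'k) \<in> to_ac ` (- \<int>)" using assms by blast
  then have "(- of_int k :: 'k) \<notin> \<int>" by (metis imageE to_ac_eq_iff ComplD)
  then show False by simp
qed

section \<open>The transform on all integer exponents\<close>

text \<open>
  Each monomial \<open>x\<^sup>\<beta>\<close> arises from the single exponent \<open>\<alpha> = - \<beta> - 1\<close>, so no sum is needed.
\<close>

definition full_laplace ::
  "('d::{finite,linorder} \<Rightarrow> 'k::field_char_0) \<Rightarrow> ('d \<Rightarrow> 'k^'n^'n) \<Rightarrow> (('d \<Rightarrow> int) \<Rightarrow> 'k^'n)
    \<Rightarrow> 'n \<Rightarrow> ('k, 'd) log_series" where
  "full_laplace \<tau> \<Lambda> Y j = (\<lambda>\<beta> m. (Y (\<lambda>i. - \<beta> i - 1) v*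
     mat_prod (\<lambda>i. laplace_coeff (\<Lambda> i) (\<tau> i) (- \<beta> i - 1) ** xpow_coeff (- \<Lambda> i) (m i))) $ j)"

lemma laplace_eq_full_laplace:
  assumes "\<And>\<alpha>. \<alpha> \<notin> orthants \<Longrightarrow> Y \<alpha> = 0"
  shows "laplace \<tau> \<Lambda> Y j = full_laplace \<tau> \<Lambda> Y j"
proof (intro ext)
  fix \<beta> :: "'a \<Rightarrow> int" and m
  let ?\<alpha> = "\<lambda>i. - \<beta> i - 1"
  have iff: "(\<forall>i. \<beta> i = - (\<alpha> i + 1)) \<longleftrightarrow> \<alpha> = ?\<alpha>" for \<alpha>
    by (force simp: fun_eq_iff)
  have "{\<alpha> \<in> orthants. \<forall>i. \<beta> i = - (\<alpha> i + 1)} = (if ?\<alpha> \<in> orthants then {?\<alpha>} else {})"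
    unfolding iff by auto
  then show "laplace \<tau> \<Lambda> Y j \<beta> m = full_laplace \<tau> \<Lambda> Y j \<beta> m"
    using assms[of ?\<alpha>] by (simp add: laplace_def full_laplace_def)
qed

text \<open>
  The next two operators are multiplication by \<open>x\<^sub>i\<close> and \<open>\<partial>\<^sub>i\<close>, transported from the series
  \<open>Y(x) x\<^sup>\<Lambda>\<close> to the family of coefficient rows of \<open>Y\<close>.
\<close>

definition coeff_shift :: "'d \<Rightarrow> (('d \<Rightarrow> int) \<Rightarrow> 'v) \<Rightarrow> ('d \<Rightarrow> int) \<Rightarrow> 'v" where
  "coeff_shift i Y = (\<lambda>\<alpha>. Y (\<alpha>(i := \<alpha> i - 1)))"

definition coeff_deriv ::
  "('d \<Rightarrow> 'k::field^'n^'n) \<Rightarrow> 'd \<Rightarrow> (('d \<Rightarrow> int) \<Rightarrow> 'k^'n) \<Rightarrow> ('d \<Rightarrow> int) \<Rightarrow> 'k^'n" where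
  "coeff_deriv \<Lambda> i Y = (\<lambda>\<alpha>. Y (\<alpha>(i := \<alpha> i + 1)) v* (\<Lambda> i + mat (of_int (\<alpha> i + 1))))"

lemma var_mult_series_xpow: "var_mult i (series_xpow \<Lambda> Y j) = series_xpow \<Lambda> (coeff_shift i Y) j"
  by (simp add: var_mult_def series_xpow_def coeff_shift_def)

text \<open>
  Differentiating \<open>x\<^sup>\<Lambda>\<close> with respect to \<open>log x\<^sub>i\<close> multiplies it by \<open>\<Lambda>\<^sub>i\<close>. The commuting factors \<open>C\<close>
  leave room for the coefficients of the Laplace transform; taking them to be the identity gives
  the derivative of \<open>x\<^sup>\<Lambda>\<close> itself.
\<close>

lemma mat_prod_xpow_Suc:
  fixes \<Lambda> C :: "'d::{finite,linorder} \<Rightarrow> 'k::field_char_0^'n^'n"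
  assumes "\<And>k l. \<Lambda> k ** \<Lambda> l = \<Lambda> l ** \<Lambda> k" "\<And>k l. \<Lambda> k ** C l = C l ** \<Lambda> k"
  shows "of_nat (m i + 1) *s (v v* mat_prod (\<lambda>k. C k ** xpow_coeff (\<Lambda> k) ((m(i := m i + 1)) k)))
    = (v v* \<Lambda> i) v* mat_prod (\<lambda>k. C k ** xpow_coeff (\<Lambda> k) (m k))"
proof -
  let ?B = "mat (1 / of_nat (m i + 1)) ** \<Lambda> i"
  have comm: "A ** ?B = ?B ** A" if "A ** \<Lambda> i = \<Lambda> i ** A" for A
    by (intro commute_mult mat_central[symmetric] that)
  have "mat_prod (\<lambda>k. C k ** xpow_coeff (\<Lambda> k) ((m(i := m i + 1)) k))
      = ?B ** mat_prod (\<lambda>k. C k ** xpow_coeff (\<Lambda> k) (m k))"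
  proof (rule mat_prod_upd)
    have "C i ** (?B ** xpow_coeff (\<Lambda> i) (m i)) = ?B ** (C i ** xpow_coeff (\<Lambda> i) (m i))"
      using comm[OF assms(2)[symmetric], of i] by (simp add: matrix_mul_assoc)
    then show "C i ** xpow_coeff (\<Lambda> i) ((m(i := m i + 1)) i)
        = ?B ** (C i ** xpow_coeff (\<Lambda> i) (m i))"
      by (simp add: xpow_coeff_Suc)
    show "?B ** (C k ** xpow_coeff (\<Lambda> k) (m k)) = C k ** xpow_coeff (\<Lambda> k) (m k) ** ?B" for k
      by (intro comm[symmetric] commute_mult[symmetric] commute_xpow_coeff assms)
  qed auto
  then show ?thesis
    by (simp add: vector_mat_mult vector_matrix_mul_assoc flip: matrix_mul_assoc del: of_nat_Suc)
qed

lemma vector_add_mat: "v v* (A + mat c) = v v* A + c *s v"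
  for v :: "'k::comm_ring_1^'n"
  using vector_mat_mult[of v c "mat 1"] by (simp add: vector_matrix_mult_add_rdistrib)

lemma var_deriv_series_xpow:
  fixes \<Lambda> :: "'d::{finite,linorder} \<Rightarrow> 'k::field_char_0^'n^'n"
  assumes "\<And>k l. \<Lambda> k ** \<Lambda> l = \<Lambda> l ** \<Lambda> k"
  shows "var_deriv i (series_xpow \<Lambda> Y j) = series_xpow \<Lambda> (coeff_deriv \<Lambda> i Y) j"
proof (intro ext)
  fix \<alpha> m
  let ?v = "Y (\<alpha>(i := \<alpha> i + 1))"
  let ?M = "mat_prod (\<lambda>k. xpow_coeff (\<Lambda> k) (m k))"
  have "of_nat (m i + 1) *s (?v v* mat_prod (\<lambda>k. xpow_coeff (\<Lambda> k) ((m(i := m i + 1)) k)))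
      = (?v v* \<Lambda> i) v* ?M"
    using mat_prod_xpow_Suc[of \<Lambda> "\<lambda>_. mat 1" m i ?v] assms by simp
  then show "var_deriv i (series_xpow \<Lambda> Y j) \<alpha> m = series_xpow \<Lambda> (coeff_deriv \<Lambda> i Y) j \<alpha> m"
    unfolding var_deriv_def series_xpow_def coeff_deriv_def vector_add_mat
    by (simp add: vec_eq_iff vector_matrix_left_distrib scalar_vector_matrix_assoc
        distrib_right del: of_int_add)
qed

section \<open>Exchange of multiplication and differentiation\<close>

context
  fixes \<tau> :: "'d::{finite,linorder} \<Rightarrow> 'k::field_char_0" and \<Lambda> :: "'d \<Rightarrow> 'k^'n^'n"
  assumes \<tau>: "\<And>i. \<tau> i \<noteq> 0"
    and comm: "\<And>i j. \<Lambda> i ** \<Lambda> j = \<Lambda> j ** \<Lambda> i"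
    and inv: "\<And>i k. invertible (\<Lambda> i + mat (of_int k))"
begin

lemma mat_prod_laplace_succ:
  "mat_prod (\<lambda>k. laplace_coeff (\<Lambda> k) (\<tau> k) ((\<alpha>(i := \<alpha> i + 1)) k) ** xpow_coeff (- \<Lambda> k) (m k))
   = mat (1 / \<tau> i) ** (\<Lambda> i + mat (of_int (\<alpha> i + 1))) **
     mat_prod (\<lambda>k. laplace_coeff (\<Lambda> k) (\<tau> k) (\<alpha> k) ** xpow_coeff (- \<Lambda> k) (m k))"
proof (rule mat_prod_upd)
  let ?B = "mat (1 / \<tau> i) ** (\<Lambda> i + mat (of_int (\<alpha> i + 1)))"
  show "laplace_coeff (\<Lambda> i) (\<tau> i) ((\<alpha>(i := \<alpha> i + 1)) i) ** xpow_coeff (- \<Lambda> i) (m i)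
      = ?B ** (laplace_coeff (\<Lambda> i) (\<tau> i) (\<alpha> i) ** xpow_coeff (- \<Lambda> i) (m i))"
    by (simp only: fun_upd_same laplace_coeff_succ[OF \<tau> inv] matrix_mul_assoc)
  have c: "?B ** \<Lambda> k = \<Lambda> k ** ?B" for k
    by (intro commute_mult[symmetric] commute_add mat_central[symmetric] comm)
  show "?B ** (laplace_coeff (\<Lambda> k) (\<tau> k) (\<alpha> k) ** xpow_coeff (- \<Lambda> k) (m k))
      = laplace_coeff (\<Lambda> k) (\<tau> k) (\<alpha> k) ** xpow_coeff (- \<Lambda> k) (m k) ** ?B" for k
    by (intro commute_mult commute_laplace_coeff commute_xpow_coeff commute_minus c inv)
qed auto

text \<open>
  In the derivative of the transformed term the integer exponent contributes \<open>- (\<alpha>\<^sub>i + 1)\<close> and the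
  logarithms contribute \<open>- \<Lambda>\<^sub>i\<close>; together with \<open>- 1 / \<tau>\<^sub>i\<close> this is the factor by which
  \<open>C\<close> changes from \<open>\<alpha>\<^sub>i\<close> to \<open>\<alpha>\<^sub>i + 1\<close>.
\<close>

lemma full_laplace_coeff_shift:
  "full_laplace \<tau> \<Lambda> (coeff_shift i Y) j
     = (\<lambda>\<beta> m. - (1 / \<tau> i) * var_deriv i (full_laplace \<tau> \<Lambda> Y j) \<beta> m)"
proof (intro ext)
  fix \<beta> :: "'d \<Rightarrow> int" and m :: "'d \<Rightarrow> nat"
  \<comment> \<open>On both sides the coefficient of \<open>x\<^sup>\<beta>\<close> involves only \<open>Y \<alpha>\<close>. On the left the shift has moved
    it to the successor of \<open>\<alpha>\<close> in direction \<open>i\<close>.\<close>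
  define \<alpha> where "\<alpha> = (\<lambda>k. - (\<beta>(i := \<beta> i + 1)) k - 1)"
  define M where "M m = mat_prod (\<lambda>k. laplace_coeff (\<Lambda> k) (\<tau> k) (\<alpha> k) **
    xpow_coeff (- \<Lambda> k) (m k))" for m
  have \<beta>: "- \<beta> k - 1 = (\<alpha>(i := \<alpha> i + 1)) k" for k
    by (simp add: \<alpha>_def)
  have \<beta>i: "\<beta> i + 1 = - (\<alpha> i + 1)" by (simp add: \<alpha>_def)
  have lhs: "full_laplace \<tau> \<Lambda> (coeff_shift i Y) j \<beta> m
      = 1 / \<tau> i * (((Y \<alpha> v* \<Lambda> i) v* M m) $ j + of_int (\<alpha> i + 1) * (Y \<alpha> v* M m) $ j)"
    unfolding full_laplace_def coeff_shift_def \<beta> mat_prod_laplace_succ M_def[symmetric]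
    unfolding matrix_mul_assoc[symmetric] vector_mat_mult
    by (simp add: vector_add_mat vector_matrix_left_distrib scalar_vector_matrix_assoc
        add_divide_distrib flip: vector_matrix_mul_assoc del: of_int_add)
  have log: "of_nat (m i + 1) *s (Y \<alpha> v* M (m(i := m i + 1))) = (Y \<alpha> v* - \<Lambda> i) v* M m"
    unfolding M_def
    by (rule mat_prod_xpow_Suc)
      (intro commute_minus commute_minus[symmetric] commute_laplace_coeff
        commute_laplace_coeff[symmetric] comm inv)+
  have neg: "(Y \<alpha> v* - \<Lambda> i) v* M m = - ((Y \<alpha> v* \<Lambda> i) v* M m)"
    by (simp add: vector_matrix_mult_def vec_eq_iff sum_negf)
  have "var_deriv i (full_laplace \<tau> \<Lambda> Y j) \<beta> m
      = of_int (\<beta> i + 1) * (Y \<alpha> v* M m) $ j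
        + (of_nat (m i + 1) *s (Y \<alpha> v* M (m(i := m i + 1)))) $ j"
    by (simp add: var_deriv_def full_laplace_def M_def \<alpha>_def distrib_right)
  then have rhs: "var_deriv i (full_laplace \<tau> \<Lambda> Y j) \<beta> m
      = - (((Y \<alpha> v* \<Lambda> i) v* M m) $ j + of_int (\<alpha> i + 1) * (Y \<alpha> v* M m) $ j)"
    unfolding log neg \<beta>i of_int_minus by (simp add: algebra_simps)
  show "full_laplace \<tau> \<Lambda> (coeff_shift i Y) j \<beta> m
      = - (1 / \<tau> i) * var_deriv i (full_laplace \<tau> \<Lambda> Y j) \<beta> m"
    by (simp only: lhs rhs minus_mult_minus)
qed

text \<open>
  Here the factor \<open>\<Lambda>\<^sub>i + \<alpha>\<^sub>i + 1\<close> produced by \<open>\<partial>\<^sub>i\<close> before the transform is the one that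
  takes \<open>C\<close> from \<open>\<alpha>\<^sub>i\<close> to \<open>\<alpha>\<^sub>i + 1\<close>.
\<close>

lemma full_laplace_coeff_deriv:
  "full_laplace \<tau> \<Lambda> (coeff_deriv \<Lambda> i Y) j
     = (\<lambda>\<beta> m. \<tau> i * var_mult i (full_laplace \<tau> \<Lambda> Y j) \<beta> m)"
proof (intro ext)
  fix \<beta> :: "'d \<Rightarrow> int" and m :: "'d \<Rightarrow> nat"
  define \<alpha> where "\<alpha> = (\<lambda>k. - \<beta> k - 1)"
  have \<beta>: "- (\<beta>(i := \<beta> i - 1)) k - 1 = (\<alpha>(i := \<alpha> i + 1)) k" for k
    by (simp add: \<alpha>_def)
  have \<alpha>: "- \<beta> k - 1 = \<alpha> k" for k by (simp add: \<alpha>_def)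
  show "full_laplace \<tau> \<Lambda> (coeff_deriv \<Lambda> i Y) j \<beta> m
      = \<tau> i * var_mult i (full_laplace \<tau> \<Lambda> Y j) \<beta> m"
    unfolding full_laplace_def coeff_deriv_def var_mult_def \<beta> \<alpha> mat_prod_laplace_succ
    using \<tau>[of i]
    by (simp add: matrix_mul_assoc[symmetric] vector_mat_mult vector_matrix_mul_assoc
        del: of_int_add)
qed

lemma is_fourier_fourier: "is_fourier \<tau> (fourier \<tau>)"
  unfolding fourier_def by (rule theI'[OF fourier_unique_existence[of \<tau>, OF \<tau>]])

lemmas fourier_laws = is_fourier_fourier[unfolded is_fourier_def weyl_automorphism_def]

text \<open>
  That one and the same \<open>Z\<close> serves both sides and all entries \<open>j\<close> lets vanishing pass from one
  side to the other. As \<open>Y\<close> is arbitrary, the property composes, so that the sums and products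
  reduce to the generators, for which \<open>Z\<close> is given by the exchange rules.
\<close>

lemma weyl_act_intertwined:
  "\<exists>Z. (\<forall>j. weyl_act \<phi> (series_xpow \<Lambda> Y j) = series_xpow \<Lambda> Z j)
     \<and> (\<forall>j. weyl_act (fourier \<tau> \<phi>) (full_laplace \<tau> \<Lambda> Y j) = full_laplace \<tau> \<Lambda> Z j)"
proof (induction \<phi> arbitrary: Y rule: weyl_induct)
  case (scal c)
  show ?case
    using fourier_laws by (intro exI[of _ "\<lambda>\<alpha>. c *s Y \<alpha>"])
      (simp add: weyl_act_scal series_xpow_def full_laplace_def scalar_vector_matrix_assoc)
next
  case (X i)
  show ?case
    using fourier_laws by (intro exI[of _ "coeff_shift i Y"])
      (simp add: weyl_act_scal weyl_act_mult weyl_act_X weyl_act_D var_mult_series_xpow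
        full_laplace_coeff_shift)
next
  case (D i)
  show ?case
    using fourier_laws by (intro exI[of _ "coeff_deriv \<Lambda> i Y"])
      (simp add: weyl_act_scal weyl_act_mult weyl_act_X weyl_act_D
        var_deriv_series_xpow[OF comm] full_laplace_coeff_deriv)
next
  case (plus a b)
  obtain Z where "\<forall>j. weyl_act a (series_xpow \<Lambda> Y j) = series_xpow \<Lambda> Z j"
    "\<forall>j. weyl_act (fourier \<tau> a) (full_laplace \<tau> \<Lambda> Y j) = full_laplace \<tau> \<Lambda> Z j"
    using plus(1) by blast
  moreover obtain Z' where "\<forall>j. weyl_act b (series_xpow \<Lambda> Y j) = series_xpow \<Lambda> Z' j"
    "\<forall>j. weyl_act (fourier \<tau> b) (full_laplace \<tau> \<Lambda> Y j) = full_laplace \<tau> \<Lambda> Z' j"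
    using plus(2) by blast
  ultimately show ?case
    using fourier_laws by (intro exI[of _ "\<lambda>\<alpha>. Z \<alpha> + Z' \<alpha>"])
      (simp add: weyl_act_add series_xpow_def full_laplace_def vector_matrix_left_distrib)
next
  case (times a b)
  obtain Z where Z: "\<forall>j. weyl_act b (series_xpow \<Lambda> Y j) = series_xpow \<Lambda> Z j"
    "\<forall>j. weyl_act (fourier \<tau> b) (full_laplace \<tau> \<Lambda> Y j) = full_laplace \<tau> \<Lambda> Z j"
    using times(2) by blast
  then show ?case
    using fourier_laws times(1)[of Z] by (simp add: weyl_act_mult)
qed

end

text \<open>The coefficients without logarithms of \<open>Z(x) x\<^sup>\<Lambda>\<close> are those of \<open>Z\<close>.\<close>

lemma series_xpow_eq_0D:
  assumes "\<And>j. series_xpow \<Lambda> Z j = (\<lambda>_ _. 0)"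
  shows "Z \<alpha> = 0"
proof -
  have "series_xpow \<Lambda> Z j \<alpha> (\<lambda>_. 0) = Z \<alpha> $ j" for j
    by (simp add: series_xpow_def xpow_coeff_0 mat_prod_one)
  then show ?thesis using assms by (simp add: vec_eq_iff)
qed

theorem proposition4p6:
  fixes \<tau> :: "'d::{finite,linorder} \<Rightarrow> 'k::field_char_0"
    and \<Lambda> :: "'d \<Rightarrow> 'k^'n^'n"
    and Y :: "('d \<Rightarrow> int) \<Rightarrow> 'k^'n"
    and \<phi> :: "('k, 'd) weyl"
  assumes "number_field TYPE('k)"
    and "\<And>i. \<tau> i \<noteq> 0"
    and "\<And>i. invertible (\<Lambda> i)"
    and "\<And>i j. \<Lambda> i ** \<Lambda> j = \<Lambda> j ** \<Lambda> i"
    and "\<And>i. eigenvalues_ac (\<Lambda> i) \<subseteq> to_ac ` (- \<int>)"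
    and "\<And>\<alpha>. \<alpha> \<notin> orthants \<Longrightarrow> Y \<alpha> = 0"
    and "\<forall>j. weyl_solution \<phi> (series_xpow \<Lambda> Y j)"
  shows "\<forall>j. weyl_solution (fourier \<tau> \<phi>) (laplace \<tau> \<Lambda> Y j)"
proof -
  have inv: "invertible (\<Lambda> i + mat (of_int k))" for i k
    by (rule invertible_add_int[OF assms(5)])
  obtain Z where Z: "\<And>j. weyl_act \<phi> (series_xpow \<Lambda> Y j) = series_xpow \<Lambda> Z j"
    "\<And>j. weyl_act (fourier \<tau> \<phi>) (full_laplace \<tau> \<Lambda> Y j) = full_laplace \<tau> \<Lambda> Z j"
    using weyl_act_intertwined[of \<tau> \<Lambda> \<phi> Y, OF assms(2,4) inv] by blast
  have "series_xpow \<Lambda> Z j = (\<lambda>_ _. 0)" for j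
    using assms(7) by (simp add: weyl_solution_def Z(1))
  then have "Z \<alpha> = 0" for \<alpha>
    by (rule series_xpow_eq_0D)
  then have "full_laplace \<tau> \<Lambda> Z j = (\<lambda>_ _. 0)" for j
    by (simp add: full_laplace_def)
  then show ?thesis
    using Z(2) by (simp add: weyl_solution_def laplace_eq_full_laplace[OF assms(6)])
qed

end
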